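(* Let $R$ be an associative ring with unit and let $M$ be a left $R$-module which is $M^{(\Lambda)}$-projective for every index set $\Lambda$. If $N$ and $L$ are locally nilpotent submodules of $M$, then $N+L$ is a locally nilpotent submodule of $M$.
   Context: Modules are unitary left modules. $M^{(\Lambda)}$ is the direct sum of copies of $M$ indexed by $\Lambda$. A module $M$ is $L'$-projective if for every epimorphism $\rho:L'\to L''$ and every homomorphism $\alpha:M\to L''$ there is $\overline{\alpha}:M\to L'$ with $\rho\overline{\alpha}=\alpha$. For submodules $A,B\leq M$ the product is $A_MB=\sum\{f(A)\mid f\in\operatorname{Hom}_R(M,B)\}$; this product is known to be associative on the lattice of submodules of $M$ when $M$ is $M^{(\Lambda)}$-projective for every $\Lambda$, so iterated products are written without brackets. A submodule $N$ of $M$ is locally nilpotent if for every finite subset $\{n_1,\dots,n_k\}\subseteq N$ there is an integer $\ell>0$ such that for any choice of $\ell$ elements $n_{i_1},\dots,n_{i_\ell}$ of $\{n_1,\dots,n_k\}$ (repetitions allowed), ${Rn_{i_1}}_M{Rn_{i_2}}_M\cdots{}_MRn_{i_\ell}=0$. *)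

theory Defs
  imports "HOL-Algebra.AbelCoset" "HOL-Algebra.Module" "HOL-Library.Countable_Set"
begin

text \<open>
  The locale \<^locale>\<open>module\<close> of the library requires a commutative ring; here \<open>R\<close> is
  an arbitrary ring with unit.  The carrier type \<open>('a, 'b) module\<close> and the predicate
  \<^locale>\<open>submodule\<close> do not depend on commutativity and are reused.
\<close>

locale left_module = R?: ring R + M?: abelian_group M
  for R :: "('a, 'r) ring_scheme" (structure) and M :: "('a, 'b, 'm) module_scheme" (structure) +
  assumes smult_closed [simp, intro]:
      "\<lbrakk>a \<in> carrier R; x \<in> carrier M\<rbrakk> \<Longrightarrow> a \<odot>\<^bsub>M\<^esub> x \<in> carrier M"
    and smult_l_distr:
      "\<lbrakk>a \<in> carrier R; b \<in> carrier R; x \<in> carrier M\<rbrakk> \<Longrightarrow>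
        (a \<oplus>\<^bsub>R\<^esub> b) \<odot>\<^bsub>M\<^esub> x = a \<odot>\<^bsub>M\<^esub> x \<oplus>\<^bsub>M\<^esub> b \<odot>\<^bsub>M\<^esub> x"
    and smult_r_distr:
      "\<lbrakk>a \<in> carrier R; x \<in> carrier M; y \<in> carrier M\<rbrakk> \<Longrightarrow>
        a \<odot>\<^bsub>M\<^esub> (x \<oplus>\<^bsub>M\<^esub> y) = a \<odot>\<^bsub>M\<^esub> x \<oplus>\<^bsub>M\<^esub> a \<odot>\<^bsub>M\<^esub> y"
    and smult_assoc1:
      "\<lbrakk>a \<in> carrier R; b \<in> carrier R; x \<in> carrier M\<rbrakk> \<Longrightarrow>
        (a \<otimes>\<^bsub>R\<^esub> b) \<odot>\<^bsub>M\<^esub> x = a \<odot>\<^bsub>M\<^esub> (b \<odot>\<^bsub>M\<^esub> x)"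
    and smult_one [simp]: "x \<in> carrier M \<Longrightarrow> \<one>\<^bsub>R\<^esub> \<odot>\<^bsub>M\<^esub> x = x"

definition module_hom ::
    "('a, 'r) ring_scheme \<Rightarrow> ('a, 'b, 'm) module_scheme \<Rightarrow> ('a, 'c, 'n) module_scheme \<Rightarrow> ('b \<Rightarrow> 'c) set"
  where "module_hom R M N = {f \<in> carrier M \<rightarrow> carrier N.
    (\<forall>x\<in>carrier M. \<forall>y\<in>carrier M. f (x \<oplus>\<^bsub>M\<^esub> y) = f x \<oplus>\<^bsub>N\<^esub> f y) \<and>
    (\<forall>a\<in>carrier R. \<forall>x\<in>carrier M. f (a \<odot>\<^bsub>M\<^esub> x) = a \<odot>\<^bsub>N\<^esub> f x)}"

definition module_epi ::
    "('a, 'r) ring_scheme \<Rightarrow> ('a, 'b, 'm) module_scheme \<Rightarrow> ('a, 'c, 'n) module_scheme \<Rightarrow> ('b \<Rightarrow> 'c) set"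
  where "module_epi R M N = {f \<in> module_hom R M N. f ` carrier M = carrier N}"

text \<open>The multiplicative fields inherited from the ring record are irrelevant for a module.\<close>

definition direct_power :: "('a, 'b, 'm) module_scheme \<Rightarrow> 'i set \<Rightarrow> ('a, 'i \<Rightarrow> 'b) module"
  where "direct_power M \<Lambda> =
    \<lparr>carrier = {x \<in> \<Lambda> \<rightarrow>\<^sub>E carrier M. finite {i \<in> \<Lambda>. x i \<noteq> \<zero>\<^bsub>M\<^esub>}},
     mult = undefined, one = undefined,
     zero = (\<lambda>i\<in>\<Lambda>. \<zero>\<^bsub>M\<^esub>),
     add = (\<lambda>x y. \<lambda>i\<in>\<Lambda>. x i \<oplus>\<^bsub>M\<^esub> y i),
     smult = (\<lambda>a x. \<lambda>i\<in>\<Lambda>. a \<odot>\<^bsub>M\<^esub> x i)\<rparr>"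

text \<open>
  \<open>M\<close> is \<open>L\<close>-projective.  HOL does not quantify over types inside a formula, so the codomain
  \<open>Q\<close> of the epimorphism ranges over the modules whose elements are sets of elements of \<open>L\<close>;
  these include all quotients of \<open>L\<close>.  Lemma \<open>rel_projectiveD\<close> below shows that this
  entails lifting along epimorphisms from \<open>L\<close> onto modules of arbitrary type.
\<close>

definition rel_projective ::
    "('a, 'r) ring_scheme \<Rightarrow> ('a, 'b, 'm) module_scheme \<Rightarrow> ('a, 'c, 'n) module_scheme \<Rightarrow> bool"
  where "rel_projective R M L \<longleftrightarrow>
    (\<forall>(Q :: ('a, 'c set) module) \<rho> \<alpha>.
      left_module R Q \<longrightarrow> \<rho> \<in> module_epi R L Q \<longrightarrow> \<alpha> \<in> module_hom R M Q \<longrightarrow>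
      (\<exists>\<beta>\<in>module_hom R M L. \<forall>x\<in>carrier M. \<rho> (\<beta> x) = \<alpha> x))"

text \<open>
  For the same reason \<open>M\<^sup>(\<^sup>\<Lambda>\<^sup>)\<close>-projectivity for every index set \<open>\<Lambda>\<close> is expressed with
  \<open>\<Lambda>\<close> ranging over all sets of type \<open>(nat \<times> 'b) set\<close>, where \<open>'b\<close> is the type of the elements
  of \<open>M\<close>.  Lemma \<open>rel_projective_all_index_sets\<close> below shows that this entails
  \<open>M\<^sup>(\<^sup>\<Lambda>\<^sup>)\<close>-projectivity for index sets of arbitrary type.
\<close>

definition submodule_sum ::
    "('a, 'b, 'm) module_scheme \<Rightarrow> ('i \<Rightarrow> 'b set) \<Rightarrow> 'i set \<Rightarrow> 'b set"
  where "submodule_sum M A I =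
    {\<Oplus>\<^bsub>M\<^esub>i\<in>F. x i | F x. finite F \<and> F \<subseteq> I \<and> (\<forall>i\<in>F. x i \<in> A i)}"

text \<open>A homomorphism from \<open>M\<close> to the submodule \<open>B\<close> is an endomorphism of \<open>M\<close> with values in \<open>B\<close>.\<close>

definition submodule_prod ::
    "('a, 'r) ring_scheme \<Rightarrow> ('a, 'b, 'm) module_scheme \<Rightarrow> 'b set \<Rightarrow> 'b set \<Rightarrow> 'b set"
  where "submodule_prod R M A B =
    submodule_sum M (\<lambda>f. f ` A) (module_hom R M (M\<lparr>carrier := B\<rparr>))"

text \<open>
  Products of nonempty lists, bracketed to the left: \<open>(\<dots>((A\<^sub>1 A\<^sub>2) A\<^sub>3)\<dots>) A\<^sub>n\<close>.
  The value on the empty list is never used.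
\<close>

definition submodule_prod_list ::
    "('a, 'r) ring_scheme \<Rightarrow> ('a, 'b, 'm) module_scheme \<Rightarrow> 'b set list \<Rightarrow> 'b set"
  where "submodule_prod_list R M As = foldl (submodule_prod R M) (hd As) (tl As)"

definition cyclic_submodule ::
    "('a, 'r) ring_scheme \<Rightarrow> ('a, 'b, 'm) module_scheme \<Rightarrow> 'b \<Rightarrow> 'b set"
  where "cyclic_submodule R M n = (\<lambda>a. a \<odot>\<^bsub>M\<^esub> n) ` carrier R"

definition locally_nilpotent ::
    "('a, 'r) ring_scheme \<Rightarrow> ('a, 'b, 'm) module_scheme \<Rightarrow> 'b set \<Rightarrow> bool"
  where "locally_nilpotent R M N \<longleftrightarrow> submodule N R M \<and>
    (\<forall>S. finite S \<and> S \<subseteq> N \<longrightarrow>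
      (\<exists>l>0. \<forall>ns. length ns = l \<and> set ns \<subseteq> S \<longrightarrow>
        submodule_prod_list R M (map (cyclic_submodule R M) ns) = {\<zero>\<^bsub>M\<^esub>}))"


subsection \<open>Adequacy of the type restrictions in the projectivity hypothesis\<close>

lemma module_homI:
  assumes "\<And>x. x \<in> carrier M \<Longrightarrow> f x \<in> carrier N"
    and "\<And>x y. \<lbrakk>x \<in> carrier M; y \<in> carrier M\<rbrakk> \<Longrightarrow> f (x \<oplus>\<^bsub>M\<^esub> y) = f x \<oplus>\<^bsub>N\<^esub> f y"
    and "\<And>a x. \<lbrakk>a \<in> carrier R; x \<in> carrier M\<rbrakk> \<Longrightarrow> f (a \<odot>\<^bsub>M\<^esub> x) = a \<odot>\<^bsub>N\<^esub> f x"
  shows "f \<in> module_hom R M N"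
  using assms by (auto simp: module_hom_def)

lemma module_homD:
  assumes "f \<in> module_hom R M N"
  shows "x \<in> carrier M \<Longrightarrow> f x \<in> carrier N"
    and "\<lbrakk>x \<in> carrier M; y \<in> carrier M\<rbrakk> \<Longrightarrow> f (x \<oplus>\<^bsub>M\<^esub> y) = f x \<oplus>\<^bsub>N\<^esub> f y"
    and "\<lbrakk>a \<in> carrier R; x \<in> carrier M\<rbrakk> \<Longrightarrow> f (a \<odot>\<^bsub>M\<^esub> x) = a \<odot>\<^bsub>N\<^esub> f x"
  using assms by (auto simp: module_hom_def)

lemma module_hom_comp:
  "\<lbrakk>f \<in> module_hom R M N; g \<in> module_hom R N P\<rbrakk> \<Longrightarrow> g \<circ> f \<in> module_hom R M P"
  by (auto simp: module_hom_def Pi_iff)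

text \<open>A structure that is the image of a module under a map preserving the operations is a module.\<close>

lemma left_module_image:
  assumes M: "left_module R M" and f: "f \<in> module_hom R M N" and surj: "f ` carrier M = carrier N"
    and z: "f \<zero>\<^bsub>M\<^esub> = \<zero>\<^bsub>N\<^esub>"
  shows "left_module R N"
proof -
  interpret M: left_module R M by (rule M)
  note fD = module_homD[OF f]
  have ex: "\<exists>x'\<in>carrier M. x = f x'" if "x \<in> carrier N" for x
    using that surj by blast
  have add: "f x \<oplus>\<^bsub>N\<^esub> f y = f (x \<oplus>\<^bsub>M\<^esub> y)" if "x \<in> carrier M" "y \<in> carrier M" for x y
    using fD(2) that by simp
  have sm: "a \<odot>\<^bsub>N\<^esub> f x = f (a \<odot>\<^bsub>M\<^esub> x)" if "a \<in> carrier R" "x \<in> carrier M" for a x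
    using fD(3) that by simp
  have "abelian_group N"
  proof (rule abelian_groupI)
    show "x \<oplus>\<^bsub>N\<^esub> y \<in> carrier N" if "x \<in> carrier N" "y \<in> carrier N" for x y
      using that ex[of x] ex[of y] by (auto simp: add fD(1))
    show "\<zero>\<^bsub>N\<^esub> \<in> carrier N" using fD(1)[of "\<zero>\<^bsub>M\<^esub>"] z by simp
    show "(x \<oplus>\<^bsub>N\<^esub> y) \<oplus>\<^bsub>N\<^esub> w = x \<oplus>\<^bsub>N\<^esub> (y \<oplus>\<^bsub>N\<^esub> w)"
      if "x \<in> carrier N" "y \<in> carrier N" "w \<in> carrier N" for x y w
      using ex[OF that(1)] ex[OF that(2)] ex[OF that(3)] by (auto simp: add M.M.a_assoc)
    show "x \<oplus>\<^bsub>N\<^esub> y = y \<oplus>\<^bsub>N\<^esub> x" if "x \<in> carrier N" "y \<in> carrier N" for x y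
      using ex[OF that(1)] ex[OF that(2)] by (auto simp: add M.M.a_comm)
    show "\<zero>\<^bsub>N\<^esub> \<oplus>\<^bsub>N\<^esub> x = x" if "x \<in> carrier N" for x
      using ex[OF that] by (auto simp: add z[symmetric])
    show "\<exists>y\<in>carrier N. y \<oplus>\<^bsub>N\<^esub> x = \<zero>\<^bsub>N\<^esub>" if x: "x \<in> carrier N" for x
    proof -
      obtain x' where x': "x' \<in> carrier M" "x = f x'" using ex[OF x] by blast
      have "f (\<ominus>\<^bsub>M\<^esub> x') \<oplus>\<^bsub>N\<^esub> x = \<zero>\<^bsub>N\<^esub>"
        using x' by (simp add: add M.M.l_neg z)
      then show ?thesis using fD(1)[of "\<ominus>\<^bsub>M\<^esub> x'"] x' by auto
    qed
  qed
  moreover have "left_module_axioms R N"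
  proof
    show "a \<odot>\<^bsub>N\<^esub> x \<in> carrier N" if "a \<in> carrier R" "x \<in> carrier N" for a x
      using that ex[of x] by (auto simp: sm fD(1))
    show "(a \<oplus>\<^bsub>R\<^esub> b) \<odot>\<^bsub>N\<^esub> x = a \<odot>\<^bsub>N\<^esub> x \<oplus>\<^bsub>N\<^esub> b \<odot>\<^bsub>N\<^esub> x"
      if "a \<in> carrier R" "b \<in> carrier R" "x \<in> carrier N" for a b x
      using that ex[of x] by (auto simp: sm add M.smult_l_distr)
    show "a \<odot>\<^bsub>N\<^esub> (x \<oplus>\<^bsub>N\<^esub> y) = a \<odot>\<^bsub>N\<^esub> x \<oplus>\<^bsub>N\<^esub> a \<odot>\<^bsub>N\<^esub> y"
      if "a \<in> carrier R" "x \<in> carrier N" "y \<in> carrier N" for a x y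
      using that ex[of x] ex[of y] by (auto simp: sm add M.smult_r_distr)
    show "(a \<otimes>\<^bsub>R\<^esub> b) \<odot>\<^bsub>N\<^esub> x = a \<odot>\<^bsub>N\<^esub> (b \<odot>\<^bsub>N\<^esub> x)"
      if "a \<in> carrier R" "b \<in> carrier R" "x \<in> carrier N" for a b x
      using that ex[of x] by (auto simp: sm M.smult_assoc1)
    show "\<one>\<^bsub>R\<^esub> \<odot>\<^bsub>N\<^esub> x = x" if "x \<in> carrier N" for x
      using that ex[of x] by (auto simp: sm)
  qed
  ultimately show ?thesis
    by (intro left_module.intro M.R.ring_axioms)
qed

lemma module_hom_zero:
  assumes "left_module R M" "left_module R N" "f \<in> module_hom R M N"
  shows "f \<zero>\<^bsub>M\<^esub> = \<zero>\<^bsub>N\<^esub>"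
proof -
  interpret M: left_module R M by fact
  interpret N: left_module R N by fact
  have "f \<zero>\<^bsub>M\<^esub> \<in> carrier N" "f \<zero>\<^bsub>M\<^esub> \<oplus>\<^bsub>N\<^esub> f \<zero>\<^bsub>M\<^esub> = f \<zero>\<^bsub>M\<^esub>"
    using module_homD(1)[OF assms(3), of "\<zero>\<^bsub>M\<^esub>"]
      module_homD(2)[OF assms(3), of "\<zero>\<^bsub>M\<^esub>" "\<zero>\<^bsub>M\<^esub>"] by auto
  then show ?thesis
    by (metis N.M.add.r_cancel_one')
qed

lemma left_module_direct_power:
  assumes "left_module R M"
  shows "left_module R (direct_power M \<Lambda>)"
proof -
  interpret M: left_module R M by fact
  let ?P = "direct_power M \<Lambda>"
  have smz: "a \<odot>\<^bsub>M\<^esub> \<zero>\<^bsub>M\<^esub> = \<zero>\<^bsub>M\<^esub>" if "a \<in> carrier R" for a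
    using M.smult_r_distr[OF that M.M.zero_closed M.M.zero_closed] M.smult_closed[OF that M.M.zero_closed]
    by (metis M.M.add.r_cancel_one' M.M.r_zero M.M.zero_closed)
  have add_cl: "x \<oplus>\<^bsub>?P\<^esub> y \<in> carrier ?P" if "x \<in> carrier ?P" "y \<in> carrier ?P" for x y
  proof -
    have "finite ({i \<in> \<Lambda>. x i \<noteq> \<zero>\<^bsub>M\<^esub>} \<union> {i \<in> \<Lambda>. y i \<noteq> \<zero>\<^bsub>M\<^esub>})"
      using that by (simp add: direct_power_def)
    then have "finite {i \<in> \<Lambda>. (x \<oplus>\<^bsub>?P\<^esub> y) i \<noteq> \<zero>\<^bsub>M\<^esub>}"
      by (rule rev_finite_subset) (auto simp: direct_power_def)
    then show ?thesis using that by (auto simp: direct_power_def PiE_iff)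
  qed
  have sm_cl: "a \<odot>\<^bsub>?P\<^esub> x \<in> carrier ?P" if "a \<in> carrier R" "x \<in> carrier ?P" for a x
  proof -
    have "finite {i \<in> \<Lambda>. x i \<noteq> \<zero>\<^bsub>M\<^esub>}"
      using that by (simp add: direct_power_def)
    then have "finite {i \<in> \<Lambda>. (a \<odot>\<^bsub>?P\<^esub> x) i \<noteq> \<zero>\<^bsub>M\<^esub>}"
      by (rule rev_finite_subset) (auto simp: direct_power_def smz[OF that(1)])
    then show ?thesis using that by (auto simp: direct_power_def PiE_iff)
  qed
  have pt: "x i \<in> carrier M" if "x \<in> carrier ?P" "i \<in> \<Lambda>" for x i
    using that by (auto simp: direct_power_def)
  have ext: "x = y" if "x \<in> carrier ?P" "y \<in> carrier ?P" "\<And>i. i \<in> \<Lambda> \<Longrightarrow> x i = y i" for x y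
    using that by (auto simp: direct_power_def intro: PiE_ext)
  have ev: "i \<in> \<Lambda> \<Longrightarrow> (x \<oplus>\<^bsub>?P\<^esub> y) i = x i \<oplus>\<^bsub>M\<^esub> y i" "i \<in> \<Lambda> \<Longrightarrow> (a \<odot>\<^bsub>?P\<^esub> x) i = a \<odot>\<^bsub>M\<^esub> x i"
    "i \<in> \<Lambda> \<Longrightarrow> \<zero>\<^bsub>?P\<^esub> i = \<zero>\<^bsub>M\<^esub>" for x y a i
    by (auto simp: direct_power_def)
  have z_cl: "\<zero>\<^bsub>?P\<^esub> \<in> carrier ?P" by (auto simp: direct_power_def)
  have "abelian_group ?P"
  proof (rule abelian_groupI)
    show "\<exists>y\<in>carrier ?P. y \<oplus>\<^bsub>?P\<^esub> x = \<zero>\<^bsub>?P\<^esub>" if x: "x \<in> carrier ?P" for x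
    proof -
      define y where "y = (\<lambda>i\<in>\<Lambda>. \<ominus>\<^bsub>M\<^esub> x i)"
      have "finite {i \<in> \<Lambda>. x i \<noteq> \<zero>\<^bsub>M\<^esub>}" using x by (simp add: direct_power_def)
      then have "finite {i \<in> \<Lambda>. y i \<noteq> \<zero>\<^bsub>M\<^esub>}"
        by (rule rev_finite_subset) (auto simp: y_def)
      then have y: "y \<in> carrier ?P"
        using pt[OF x] by (auto simp: direct_power_def y_def)
      have "y \<oplus>\<^bsub>?P\<^esub> x = \<zero>\<^bsub>?P\<^esub>"
        by (rule ext) (use x y pt[OF x] in \<open>auto simp: add_cl z_cl ev y_def M.M.l_neg\<close>)
      then show ?thesis using y by blast
    qed
    show "(x \<oplus>\<^bsub>?P\<^esub> y) \<oplus>\<^bsub>?P\<^esub> w = x \<oplus>\<^bsub>?P\<^esub> (y \<oplus>\<^bsub>?P\<^esub> w)"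
      if "x \<in> carrier ?P" "y \<in> carrier ?P" "w \<in> carrier ?P" for x y w
      by (rule ext) (use that in \<open>simp_all add: add_cl ev pt M.M.a_assoc\<close>)
    show "x \<oplus>\<^bsub>?P\<^esub> y = y \<oplus>\<^bsub>?P\<^esub> x" if "x \<in> carrier ?P" "y \<in> carrier ?P" for x y
      by (rule ext) (use that in \<open>simp_all add: add_cl ev pt M.M.a_comm\<close>)
    show "\<zero>\<^bsub>?P\<^esub> \<oplus>\<^bsub>?P\<^esub> x = x" if "x \<in> carrier ?P" for x
      by (rule ext) (use that in \<open>simp_all add: add_cl z_cl ev pt\<close>)
  qed (simp_all add: add_cl z_cl)
  moreover have "left_module_axioms R ?P"
    by unfold_locales
      (auto simp: add_cl sm_cl ev pt M.smult_l_distr M.smult_r_distr M.smult_assoc1 intro!: ext)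
  ultimately show ?thesis
    by (intro left_module.intro M.R.ring_axioms)
qed

lemma rel_projectiveD:
  fixes L :: "('a, 'c, 'n) module_scheme" and Q :: "('a, 'd, 'k) module_scheme"
  assumes L: "left_module R L" and Q: "left_module R Q"
    and proj: "rel_projective R M L"
    and \<rho>: "\<rho> \<in> module_epi R L Q" and \<alpha>: "\<alpha> \<in> module_hom R M Q"
  shows "\<exists>\<beta>\<in>module_hom R M L. \<forall>x\<in>carrier M. \<rho> (\<beta> x) = \<alpha> x"
proof -
  interpret Q: left_module R Q by (rule Q)
  have \<rho>h: "\<rho> \<in> module_hom R L Q" and \<rho>s: "\<rho> ` carrier L = carrier Q"
    using \<rho> by (auto simp: module_epi_def)
  define \<phi> where "\<phi> y = {x \<in> carrier L. \<rho> x = y}" for y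
  define \<psi> where "\<psi> = inv_into (carrier Q) \<phi>"
  have inj: "inj_on \<phi> (carrier Q)"
  proof (rule inj_onI)
    fix x y assume xy: "x \<in> carrier Q" "y \<in> carrier Q" "\<phi> x = \<phi> y"
    have "x \<in> \<rho> ` carrier L" using xy(1) \<rho>s by simp
    then obtain z where z: "z \<in> carrier L" "x = \<rho> z" by (rule imageE)
    then have "z \<in> \<phi> x" by (simp add: \<phi>_def)
    then have "z \<in> \<phi> y" using xy(3) by simp
    then show "x = y" using z by (simp add: \<phi>_def)
  qed
  have \<psi>: "\<psi> (\<phi> y) = y" if "y \<in> carrier Q" for y
    using inj that by (simp add: \<psi>_def)
  define T :: "('a, 'c set) module" where "T =
    \<lparr>carrier = \<phi> ` carrier Q, mult = undefined, one = undefined, zero = \<phi> \<zero>\<^bsub>Q\<^esub>,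
     add = (\<lambda>x y. \<phi> (\<psi> x \<oplus>\<^bsub>Q\<^esub> \<psi> y)), smult = (\<lambda>a x. \<phi> (a \<odot>\<^bsub>Q\<^esub> \<psi> x))\<rparr>"
  have \<phi>h: "\<phi> \<in> module_hom R Q T"
    by (rule module_homI) (auto simp: T_def \<psi>)
  have T: "left_module R T"
    by (rule left_module_image[OF Q \<phi>h]) (auto simp: T_def)
  have "\<phi> \<circ> \<rho> \<in> module_epi R L T"
    using module_hom_comp[OF \<rho>h \<phi>h] image_comp[of \<phi> \<rho> "carrier L"]
    by (simp add: module_epi_def \<rho>s) (simp add: T_def)
  moreover have "\<phi> \<circ> \<alpha> \<in> module_hom R M T"
    using module_hom_comp[OF \<alpha> \<phi>h] .
  ultimately obtain \<beta> where \<beta>: "\<beta> \<in> module_hom R M L"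
    "\<And>x. x \<in> carrier M \<Longrightarrow> (\<phi> \<circ> \<rho>) (\<beta> x) = (\<phi> \<circ> \<alpha>) x"
    using proj T unfolding rel_projective_def by meson
  have "\<rho> (\<beta> x) = \<alpha> x" if "x \<in> carrier M" for x
    using \<beta>(2)[OF that] inj module_homD(1)[OF \<alpha> that]
      module_homD(1)[OF \<rho>h module_homD(1)[OF \<beta>(1) that]] by (auto dest: inj_onD)
  with \<beta>(1) show ?thesis by blast
qed

lemma rel_projective_all_index_sets:
  fixes M :: "('a, 'b, 'm) module_scheme" and \<Lambda> :: "'i set"
  assumes M: "left_module R M"
    and proj: "\<And>\<Lambda> :: (nat \<times> 'b) set. rel_projective R M (direct_power M \<Lambda>)"
  shows "rel_projective R M (direct_power M \<Lambda>)"
  unfolding rel_projective_def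
proof (intro allI impI)
  fix Q :: "('a, ('i \<Rightarrow> 'b) set) module" and \<rho> \<alpha>
  assume Q: "left_module R Q" and \<rho>: "\<rho> \<in> module_epi R (direct_power M \<Lambda>) Q"
    and \<alpha>: "\<alpha> \<in> module_hom R M Q"
  interpret M: left_module R M by (rule M)
  let ?P = "direct_power M \<Lambda>"
  have \<rho>h: "\<rho> \<in> module_hom R ?P Q" and \<rho>s: "\<rho> ` carrier ?P = carrier Q"
    using \<rho> by (auto simp: module_epi_def)
  have "\<forall>m\<in>carrier M. \<exists>x\<in>carrier ?P. \<rho> x = \<alpha> m"
    using \<rho>s module_homD(1)[OF \<alpha>] by (metis imageE)
  then obtain x where x: "\<And>m. m \<in> carrier M \<Longrightarrow> x m \<in> carrier ?P"
      "\<And>m. m \<in> carrier M \<Longrightarrow> \<rho> (x m) = \<alpha> m"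
    by metis
  define supp where "supp m = {i \<in> \<Lambda>. x m i \<noteq> \<zero>\<^bsub>M\<^esub>}" for m
  have fin: "finite (supp m)" if "m \<in> carrier M" for m
    using x(1)[OF that] by (simp add: supp_def direct_power_def)
  define \<Lambda>' where "\<Lambda>' = (\<Union>m\<in>carrier M. supp m)"
  have sub: "\<Lambda>' \<subseteq> \<Lambda>" by (auto simp: \<Lambda>'_def supp_def)
  have "\<forall>i\<in>\<Lambda>'. \<exists>m\<in>carrier M. i \<in> supp m" by (auto simp: \<Lambda>'_def)
  then obtain \<mu> where \<mu>: "\<And>i. i \<in> \<Lambda>' \<Longrightarrow> \<mu> i \<in> carrier M \<and> i \<in> supp (\<mu> i)"
    by metis
  define e where "e i = (to_nat_on (supp (\<mu> i)) i, \<mu> i)" for i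
  have inj: "inj_on e \<Lambda>'"
  proof (rule inj_onI)
    fix i j assume ij: "i \<in> \<Lambda>'" "j \<in> \<Lambda>'" "e i = e j"
    then have "\<mu> i = \<mu> j" by (simp add: e_def)
    moreover have "countable (supp (\<mu> i))"
      using fin \<mu> ij(1) by (simp add: countable_finite)
    ultimately show "i = j"
      using ij \<mu>[OF ij(1)] \<mu>[OF ij(2)] by (auto simp: e_def to_nat_on_inj)
  qed
  define \<Lambda>2 where "\<Lambda>2 = e ` \<Lambda>'"
  let ?P2 = "direct_power M \<Lambda>2"
  have P2: "left_module R ?P2" by (rule left_module_direct_power[OF M])
  define \<iota> where "\<iota> y = (\<lambda>i\<in>\<Lambda>. if i \<in> \<Lambda>' then y (e i) else \<zero>\<^bsub>M\<^esub>)" for y :: "nat \<times> 'b \<Rightarrow> 'b"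
  have smz: "a \<odot>\<^bsub>M\<^esub> \<zero>\<^bsub>M\<^esub> = \<zero>\<^bsub>M\<^esub>" if "a \<in> carrier R" for a
    using M.smult_r_distr[OF that M.M.zero_closed M.M.zero_closed] M.smult_closed[OF that M.M.zero_closed]
    by (metis M.M.add.r_cancel_one' M.M.r_zero M.M.zero_closed)
  have \<iota>h: "\<iota> \<in> module_hom R ?P2 ?P"
  proof (rule module_homI)
    fix y assume y: "y \<in> carrier ?P2"
    have "finite {j \<in> \<Lambda>2. y j \<noteq> \<zero>\<^bsub>M\<^esub>}" using y by (simp add: direct_power_def)
    then have "finite {i \<in> \<Lambda>'. e i \<in> {j \<in> \<Lambda>2. y j \<noteq> \<zero>\<^bsub>M\<^esub>}}"
      using finite_vimage_IntI[OF _ inj, of "{j \<in> \<Lambda>2. y j \<noteq> \<zero>\<^bsub>M\<^esub>}"]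
      by (simp add: vimage_def Int_def conj_commute)
    then have "finite {i \<in> \<Lambda>. \<iota> y i \<noteq> \<zero>\<^bsub>M\<^esub>}"
      by (rule rev_finite_subset) (auto simp: \<iota>_def \<Lambda>2_def split: if_splits)
    then show "\<iota> y \<in> carrier ?P"
      using y by (auto simp: direct_power_def \<iota>_def \<Lambda>2_def PiE_iff)
  next
    fix y z assume "y \<in> carrier ?P2" "z \<in> carrier ?P2"
    then show "\<iota> (y \<oplus>\<^bsub>?P2\<^esub> z) = \<iota> y \<oplus>\<^bsub>?P\<^esub> \<iota> z"
      by (auto simp: direct_power_def \<iota>_def \<Lambda>2_def fun_eq_iff restrict_def)
  next
    fix a y assume "a \<in> carrier R" "y \<in> carrier ?P2"
    then show "\<iota> (a \<odot>\<^bsub>?P2\<^esub> y) = a \<odot>\<^bsub>?P\<^esub> \<iota> y"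
      by (auto simp: direct_power_def \<iota>_def \<Lambda>2_def fun_eq_iff restrict_def smz)
  qed
  have \<rho>\<iota>: "\<rho> \<circ> \<iota> \<in> module_hom R ?P2 Q" by (rule module_hom_comp[OF \<iota>h \<rho>h])
  define Q' where "Q' = Q\<lparr>carrier := (\<rho> \<circ> \<iota>) ` carrier ?P2\<rparr>"
  have \<rho>\<iota>': "\<rho> \<circ> \<iota> \<in> module_hom R ?P2 Q'"
    using \<rho>\<iota> by (auto simp: module_hom_def Q'_def)
  have Q': "left_module R Q'"
    by (rule left_module_image[OF P2 \<rho>\<iota>'])
      (use module_hom_zero[OF P2 Q \<rho>\<iota>] in \<open>auto simp: Q'_def\<close>)
  have epi: "\<rho> \<circ> \<iota> \<in> module_epi R ?P2 Q'"
    using \<rho>\<iota>' by (auto simp: module_epi_def Q'_def)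
  have "\<alpha> m \<in> carrier Q'" if m: "m \<in> carrier M" for m
  proof -
    define y where "y = (\<lambda>j\<in>\<Lambda>2. x m (inv_into \<Lambda>' e j))"
    have ye: "y (e i) = x m i" if "i \<in> \<Lambda>'" for i
      using that inj by (simp add: y_def \<Lambda>2_def)
    have "finite (e ` supp m)" using fin[OF m] by simp
    then have "finite {j \<in> \<Lambda>2. y j \<noteq> \<zero>\<^bsub>M\<^esub>}"
      by (rule rev_finite_subset) (use sub in \<open>auto simp: \<Lambda>2_def ye supp_def\<close>)
    moreover have "y j \<in> carrier M" if "j \<in> \<Lambda>2" for j
    proof -
      obtain i where i: "i \<in> \<Lambda>'" "j = e i" using \<open>j \<in> \<Lambda>2\<close> by (auto simp: \<Lambda>2_def)
      then show ?thesis using x(1)[OF m] sub ye[OF i(1)] by (auto simp: direct_power_def)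
    qed
    ultimately have y: "y \<in> carrier ?P2"
      by (auto simp: direct_power_def y_def)
    have "\<iota> y = x m"
    proof
      fix i
      have "x m i = \<zero>\<^bsub>M\<^esub>" if "i \<in> \<Lambda>" "i \<notin> \<Lambda>'"
        using that m by (auto simp: \<Lambda>'_def supp_def)
      moreover have "x m i = undefined" if "i \<notin> \<Lambda>"
        using that x(1)[OF m] by (auto simp: direct_power_def)
      ultimately show "\<iota> y i = x m i"
        using ye by (auto simp: \<iota>_def)
    qed
    then have "\<alpha> m = (\<rho> \<circ> \<iota>) y" using x(2)[OF m] by simp
    then show ?thesis using y by (simp add: Q'_def)
  qed
  then have "\<alpha> \<in> module_hom R M Q'"
    using \<alpha> by (auto simp: module_hom_def Q'_def)
  from rel_projectiveD[OF P2 Q' proj epi this]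
  obtain \<beta> where \<beta>: "\<beta> \<in> module_hom R M ?P2"
    "\<And>m. m \<in> carrier M \<Longrightarrow> (\<rho> \<circ> \<iota>) (\<beta> m) = \<alpha> m" by blast
  have "\<iota> \<circ> \<beta> \<in> module_hom R M ?P" by (rule module_hom_comp[OF \<beta>(1) \<iota>h])
  moreover have "\<forall>m\<in>carrier M. \<rho> ((\<iota> \<circ> \<beta>) m) = \<alpha> m" using \<beta>(2) by simp
  ultimately show "\<exists>\<beta>\<in>module_hom R M ?P. \<forall>m\<in>carrier M. \<rho> (\<beta> m) = \<alpha> m"
    by blast
qed

end

theory Submission
  imports Defs "HOL-Library.Sublist"
begin

text \<open>
  An endomorphism \<open>g\<close> kills \<open>A\<^sub>1 \<dots> A\<^sub>k\<close> iff it kills \<open>f\<^sub>k (\<dots> f\<^sub>2 (a))\<close> for all \<open>a \<in> A\<^sub>1\<close> and all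
  homomorphisms \<open>f\<^sub>i\<close> from \<open>M\<close> to \<open>A\<^sub>i\<close>, so everything can be done with compositions of homomorphisms.
  Projectivity relative to \<open>M \<oplus> M\<close> splits every homomorphism into \<open>B + C\<close> as a sum of one
  into \<open>B\<close> and one into \<open>C\<close>; hence a product of the \<open>R (n\<^sub>i + l\<^sub>i)\<close> vanishes once all products
  with factors \<open>R n\<^sub>i\<close> or \<open>R l\<^sub>i\<close> do.  In a long word of the latter kind many factors come from the
  \<open>n\<^sub>i\<close> or many from the \<open>l\<^sub>i\<close>; the others are absorbed, because a
  homomorphism into \<open>A\<close> precomposed with an endomorphism is again one into \<open>A\<close>.  Associativity of the
  product is not needed.
\<close>

section \<open>Submodules and quotient modules\<close>

context left_module
begin

lemma submoduleI:
  assumes "H \<subseteq> carrier M" "\<zero>\<^bsub>M\<^esub> \<in> H"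
    and "\<And>x y. \<lbrakk>x \<in> H; y \<in> H\<rbrakk> \<Longrightarrow> x \<oplus>\<^bsub>M\<^esub> y \<in> H"
    and "\<And>x. x \<in> H \<Longrightarrow> \<ominus>\<^bsub>M\<^esub> x \<in> H"
    and "\<And>a x. \<lbrakk>a \<in> carrier R; x \<in> H\<rbrakk> \<Longrightarrow> a \<odot>\<^bsub>M\<^esub> x \<in> H"
  shows "submodule H R M"
  using assms by (auto simp: submodule_def subgroup_def submodule_axioms_def a_inv_def)

lemma submoduleD:
  assumes "submodule H R M"
  shows "H \<subseteq> carrier M" and "\<zero>\<^bsub>M\<^esub> \<in> H"
    and "\<lbrakk>x \<in> H; y \<in> H\<rbrakk> \<Longrightarrow> x \<oplus>\<^bsub>M\<^esub> y \<in> H"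
    and "x \<in> H \<Longrightarrow> \<ominus>\<^bsub>M\<^esub> x \<in> H"
    and "\<lbrakk>a \<in> carrier R; x \<in> H\<rbrakk> \<Longrightarrow> a \<odot>\<^bsub>M\<^esub> x \<in> H"
  using assms by (auto simp: submodule_def subgroup_def submodule_axioms_def a_inv_def)

lemma smult_r_null:
  assumes "a \<in> carrier R"
  shows "a \<odot>\<^bsub>M\<^esub> \<zero>\<^bsub>M\<^esub> = \<zero>\<^bsub>M\<^esub>"
proof -
  have "a \<odot>\<^bsub>M\<^esub> \<zero>\<^bsub>M\<^esub> \<oplus>\<^bsub>M\<^esub> a \<odot>\<^bsub>M\<^esub> \<zero>\<^bsub>M\<^esub> = a \<odot>\<^bsub>M\<^esub> \<zero>\<^bsub>M\<^esub>"
    using smult_r_distr[OF assms M.zero_closed M.zero_closed] by simp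
  then show ?thesis
    using M.add.r_cancel_one'[of "a \<odot>\<^bsub>M\<^esub> \<zero>\<^bsub>M\<^esub>" "a \<odot>\<^bsub>M\<^esub> \<zero>\<^bsub>M\<^esub>"] smult_closed[OF assms M.zero_closed]
    by auto
qed

lemma smult_r_minus:
  assumes "a \<in> carrier R" "x \<in> carrier M"
  shows "a \<odot>\<^bsub>M\<^esub> (\<ominus>\<^bsub>M\<^esub> x) = \<ominus>\<^bsub>M\<^esub> (a \<odot>\<^bsub>M\<^esub> x)"
  using assms smult_r_distr[of a "\<ominus>\<^bsub>M\<^esub> x" x]
  by (intro M.minus_equality[symmetric]) (simp_all add: M.l_neg smult_r_null)

lemma submodule_cyclic:
  assumes "n \<in> carrier M"
  shows "submodule (cyclic_submodule R M n) R M"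
proof (rule submoduleI)
  have z: "\<zero>\<^bsub>R\<^esub> \<odot>\<^bsub>M\<^esub> n = \<zero>\<^bsub>M\<^esub>"
    using assms smult_l_distr[of "\<zero>\<^bsub>R\<^esub>" "\<zero>\<^bsub>R\<^esub>" n]
      M.add.r_cancel_one'[of "\<zero>\<^bsub>R\<^esub> \<odot>\<^bsub>M\<^esub> n" "\<zero>\<^bsub>R\<^esub> \<odot>\<^bsub>M\<^esub> n"]
    by auto
  then show "\<zero>\<^bsub>M\<^esub> \<in> cyclic_submodule R M n"
    unfolding cyclic_submodule_def by (metis R.zero_closed image_eqI)
  fix x assume "x \<in> cyclic_submodule R M n"
  then obtain a where a: "a \<in> carrier R" "x = a \<odot>\<^bsub>M\<^esub> n"
    by (auto simp: cyclic_submodule_def)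
  have "\<ominus>\<^bsub>M\<^esub> x = (\<ominus>\<^bsub>R\<^esub> a) \<odot>\<^bsub>M\<^esub> n"
    using a assms z smult_l_distr[of "\<ominus>\<^bsub>R\<^esub> a" a n]
    by (simp add: M.minus_equality R.l_neg)
  then show "\<ominus>\<^bsub>M\<^esub> x \<in> cyclic_submodule R M n"
    using a by (simp add: cyclic_submodule_def)
qed (use assms in \<open>auto simp: cyclic_submodule_def simp flip: smult_l_distr smult_assoc1\<close>)

lemma submodule_set_add:
  assumes B: "submodule B R M" and C: "submodule C R M"
  shows "submodule (B <+>\<^bsub>M\<^esub> C) R M"
proof (rule submoduleI)
  note BD = submoduleD[OF B] and CD = submoduleD[OF C]
  show "B <+>\<^bsub>M\<^esub> C \<subseteq> carrier M"
    using BD(1) CD(1) by (auto simp: set_add_def')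
  show "\<zero>\<^bsub>M\<^esub> \<in> B <+>\<^bsub>M\<^esub> C"
    using BD(2) CD(2) by (force simp: set_add_def')
  fix x assume "x \<in> B <+>\<^bsub>M\<^esub> C"
  then obtain b c where x: "b \<in> B" "c \<in> C" "x = b \<oplus>\<^bsub>M\<^esub> c"
    by (auto simp: set_add_def')
  then have bc: "b \<in> carrier M" "c \<in> carrier M" using BD(1) CD(1) by auto
  show "\<ominus>\<^bsub>M\<^esub> x \<in> B <+>\<^bsub>M\<^esub> C"
    using x bc BD(4) CD(4) by (auto simp: set_add_def' M.minus_add)
  show "a \<odot>\<^bsub>M\<^esub> x \<in> B <+>\<^bsub>M\<^esub> C" if a: "a \<in> carrier R" for a
  proof -
    have "a \<odot>\<^bsub>M\<^esub> x = a \<odot>\<^bsub>M\<^esub> b \<oplus>\<^bsub>M\<^esub> a \<odot>\<^bsub>M\<^esub> c" using a x bc by (simp add: smult_r_distr)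
    then show ?thesis using BD(5)[OF a x(1)] CD(5)[OF a x(2)] by (auto simp: set_add_def')
  qed
  fix y assume "y \<in> B <+>\<^bsub>M\<^esub> C"
  then obtain b' c' where y: "b' \<in> B" "c' \<in> C" "y = b' \<oplus>\<^bsub>M\<^esub> c'"
    by (auto simp: set_add_def')
  then have "b' \<in> carrier M" "c' \<in> carrier M" using BD(1) CD(1) by auto
  then have "x \<oplus>\<^bsub>M\<^esub> y = (b \<oplus>\<^bsub>M\<^esub> b') \<oplus>\<^bsub>M\<^esub> (c \<oplus>\<^bsub>M\<^esub> c')"
    using x y bc by (simp add: M.a_ac)
  then show "x \<oplus>\<^bsub>M\<^esub> y \<in> B <+>\<^bsub>M\<^esub> C"
    using BD(3)[OF x(1) y(1)] CD(3)[OF x(2) y(2)] by (auto simp: set_add_def')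
qed

text \<open>The cosets of \<open>K\<close> serve as elements, so the carrier type of
  \<open>Q\<close> is the one over which the codomains in \<open>rel_projective\<close> range. The
  equivalence for \<open>\<phi>\<close> says that its kernel is \<open>K\<close>.\<close>

lemma quotient_module_exists:
  assumes K: "submodule K R M"
  obtains Q :: "('a, 'b set) module" and \<phi>
  where "left_module R Q" "\<phi> \<in> module_epi R M Q"
    "\<And>x y. \<lbrakk>x \<in> carrier M; y \<in> carrier M\<rbrakk> \<Longrightarrow> \<phi> x = \<phi> y \<longleftrightarrow> x \<ominus>\<^bsub>M\<^esub> y \<in> K"
proof -
  note KD = submoduleD[OF K]
  define \<phi> where "\<phi> x = {y \<in> carrier M. y \<ominus>\<^bsub>M\<^esub> x \<in> K}" for x
  have tr: "x \<ominus>\<^bsub>M\<^esub> z \<in> K"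
    if "x \<ominus>\<^bsub>M\<^esub> y \<in> K" "y \<ominus>\<^bsub>M\<^esub> z \<in> K" "x \<in> carrier M" "y \<in> carrier M" "z \<in> carrier M" for x y z
  proof -
    have "x \<ominus>\<^bsub>M\<^esub> z = (x \<ominus>\<^bsub>M\<^esub> y) \<oplus>\<^bsub>M\<^esub> (y \<ominus>\<^bsub>M\<^esub> z)"
      using that(3-5) by (simp add: M.minus_eq M.a_assoc M.r_neg1)
    then show ?thesis using KD(3) that(1,2) by simp
  qed
  have sy: "y \<ominus>\<^bsub>M\<^esub> x \<in> K" if "x \<ominus>\<^bsub>M\<^esub> y \<in> K" "x \<in> carrier M" "y \<in> carrier M" for x y
  proof -
    have "y \<ominus>\<^bsub>M\<^esub> x = \<ominus>\<^bsub>M\<^esub> (x \<ominus>\<^bsub>M\<^esub> y)"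
      using that(2,3) by (simp add: M.minus_eq M.minus_add M.a_comm)
    then show ?thesis using KD(4) that(1) by simp
  qed
  have iff: "\<phi> x = \<phi> y \<longleftrightarrow> x \<ominus>\<^bsub>M\<^esub> y \<in> K" if xy: "x \<in> carrier M" "y \<in> carrier M" for x y
  proof
    have "x \<in> \<phi> x" using xy KD(2) by (simp add: \<phi>_def M.minus_eq M.r_neg)
    then show "x \<ominus>\<^bsub>M\<^esub> y \<in> K" if "\<phi> x = \<phi> y" unfolding that by (simp add: \<phi>_def)
    show "\<phi> x = \<phi> y" if "x \<ominus>\<^bsub>M\<^esub> y \<in> K"
      using that tr sy xy unfolding \<phi>_def by blast
  qed
  \<comment> \<open>\<open>\<psi>\<close> picks a representative of each coset. The operations of
    \<open>Q\<close> are computed on representatives, and they agree with those of \<open>M\<close>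
    because a representative differs from the given element by an element of
    \<open>K\<close>.\<close>
  define \<psi> where "\<psi> = inv_into (carrier M) \<phi>"
  have \<psi>: "\<psi> (\<phi> x) \<in> carrier M" "x \<ominus>\<^bsub>M\<^esub> \<psi> (\<phi> x) \<in> K" if "x \<in> carrier M" for x
    using inv_into_into[of "\<phi> x" \<phi> "carrier M"] f_inv_into_f[of "\<phi> x" \<phi> "carrier M"] that
    by (auto simp: \<psi>_def simp flip: iff)
  define Q :: "('a, 'b set) module" where "Q =
    \<lparr>carrier = \<phi> ` carrier M, mult = undefined, one = undefined, zero = \<phi> \<zero>\<^bsub>M\<^esub>,
     add = (\<lambda>x y. \<phi> (\<psi> x \<oplus>\<^bsub>M\<^esub> \<psi> y)), smult = (\<lambda>a x. \<phi> (a \<odot>\<^bsub>M\<^esub> \<psi> x))\<rparr>"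
  have \<phi>h: "\<phi> \<in> module_hom R M Q"
  proof (rule module_homI)
    fix x assume x: "x \<in> carrier M"
    show "\<phi> x \<in> carrier Q" using x by (simp add: Q_def)
    fix y assume y: "y \<in> carrier M"
    have "(x \<oplus>\<^bsub>M\<^esub> y) \<ominus>\<^bsub>M\<^esub> (\<psi> (\<phi> x) \<oplus>\<^bsub>M\<^esub> \<psi> (\<phi> y)) = (x \<ominus>\<^bsub>M\<^esub> \<psi> (\<phi> x)) \<oplus>\<^bsub>M\<^esub> (y \<ominus>\<^bsub>M\<^esub> \<psi> (\<phi> y))"
      using x y \<psi>(1) by (simp add: M.minus_eq M.minus_add M.a_ac)
    then show "\<phi> (x \<oplus>\<^bsub>M\<^esub> y) = \<phi> x \<oplus>\<^bsub>Q\<^esub> \<phi> y"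
      using x y \<psi> KD(3) by (simp add: Q_def iff)
  next
    fix a x assume ax: "a \<in> carrier R" "x \<in> carrier M"
    have "a \<odot>\<^bsub>M\<^esub> x \<ominus>\<^bsub>M\<^esub> a \<odot>\<^bsub>M\<^esub> \<psi> (\<phi> x) = a \<odot>\<^bsub>M\<^esub> (x \<ominus>\<^bsub>M\<^esub> \<psi> (\<phi> x))"
      using ax \<psi>(1) by (simp add: M.minus_eq smult_r_distr smult_r_minus)
    then show "\<phi> (a \<odot>\<^bsub>M\<^esub> x) = a \<odot>\<^bsub>Q\<^esub> \<phi> x"
      using ax \<psi> KD(5) by (simp add: Q_def iff)
  qed
  have "left_module R Q"
    by (rule left_module_image[OF left_module_axioms \<phi>h]) (auto simp: Q_def)
  moreover have "\<phi> \<in> module_epi R M Q"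
    using \<phi>h by (simp add: module_epi_def Q_def)
  ultimately show thesis using that iff by blast
qed

end

section \<open>Lifting homomorphisms by projectivity\<close>

text \<open>Let \<open>K\<close> be the kernel of \<open>\<sigma>\<close>. The image of
  \<open>\<sigma>\<close> is isomorphic to \<open>D/K\<close>, which sits inside \<open>P/K\<close>,
  so \<open>\<alpha>\<close> induces a map from \<open>M\<close> to \<open>P/K\<close> and lifts to
  \<open>P\<close>. The lift differs from a map into \<open>D\<close> by values in \<open>K\<close>,
  hence stays in \<open>D\<close>. In this way projectivity relative to \<open>P\<close> passes to
  submodules of \<open>P\<close>; the assumption \<open>sub\<close> takes the place of surjectivity
  of \<open>\<sigma>\<close>.\<close>

lemma rel_projective_lift_submodule:
  fixes P :: "('a, 'd, 'p) module_scheme"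
  assumes M: "left_module R M" and P: "left_module R P" and X: "left_module R X"
    and proj: "rel_projective R M P" and D: "submodule D R P"
    and \<sigma>: "\<sigma> \<in> module_hom R (P\<lparr>carrier := D\<rparr>) X"
    and \<alpha>: "\<alpha> \<in> module_hom R M X" and sub: "\<alpha> ` carrier M \<subseteq> \<sigma> ` D"
  shows "\<exists>\<beta>\<in>module_hom R M (P\<lparr>carrier := D\<rparr>). \<forall>x\<in>carrier M. \<sigma> (\<beta> x) = \<alpha> x"
proof -
  interpret P: left_module R P by (rule P)
  interpret X: left_module R X by (rule X)
  interpret M: left_module R M by (rule M)
  note DD = P.submoduleD[OF D]
  have DP: "d \<in> carrier P" if "d \<in> D" for d using that DD(1) by blast
  have \<sigma>D: "d \<in> D \<Longrightarrow> \<sigma> d \<in> carrier X" "\<lbrakk>d \<in> D; e \<in> D\<rbrakk> \<Longrightarrow> \<sigma> (d \<oplus>\<^bsub>P\<^esub> e) = \<sigma> d \<oplus>\<^bsub>X\<^esub> \<sigma> e"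
    "\<lbrakk>a \<in> carrier R; d \<in> D\<rbrakk> \<Longrightarrow> \<sigma> (a \<odot>\<^bsub>P\<^esub> d) = a \<odot>\<^bsub>X\<^esub> \<sigma> d" for a d e
    using module_homD[OF \<sigma>] by auto
  \<comment> \<open>Additivity of \<open>\<sigma>\<close> is known on \<open>D\<close> only, so
    zero, negatives and differences are handled inside \<open>D\<close>.\<close>
  have \<sigma>z: "\<sigma> \<zero>\<^bsub>P\<^esub> = \<zero>\<^bsub>X\<^esub>"
    using \<sigma>D(1)[OF DD(2)] \<sigma>D(2)[OF DD(2) DD(2)] by (metis P.M.l_zero P.M.zero_closed X.M.add.r_cancel_one')
  have \<sigma>m: "\<sigma> (\<ominus>\<^bsub>P\<^esub> d) = \<ominus>\<^bsub>X\<^esub> \<sigma> d" if "d \<in> D" for d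
    using \<sigma>D(2)[OF DD(4)[OF that] that] \<sigma>z DP[OF that] \<sigma>D(1) DD(4) that
    by (metis P.M.l_neg X.M.minus_equality)
  have \<sigma>d: "\<sigma> (d \<ominus>\<^bsub>P\<^esub> e) = \<sigma> d \<ominus>\<^bsub>X\<^esub> \<sigma> e" if "d \<in> D" "e \<in> D" for d e
    using that by (simp add: P.M.minus_eq X.M.minus_eq \<sigma>D DD(4) \<sigma>m)
  have Xminus: "x \<ominus>\<^bsub>X\<^esub> y = \<zero>\<^bsub>X\<^esub> \<longleftrightarrow> x = y" if "x \<in> carrier X" "y \<in> carrier X" for x y
    using that by (metis X.M.add.inv_solve_right X.M.l_zero X.M.minus_eq X.M.zero_closed)
  define K where "K = {d \<in> D. \<sigma> d = \<zero>\<^bsub>X\<^esub>}"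
  have "submodule K R P"
    by (rule P.submoduleI)
      (use DD DP in \<open>auto simp: K_def \<sigma>D \<sigma>z \<sigma>m X.smult_r_null\<close>)
  from P.quotient_module_exists[OF this]
  obtain Q :: "('a, 'd set) module" and \<phi> where Q: "left_module R Q"
    and epi: "\<phi> \<in> module_epi R P Q"
    and \<phi>: "\<And>x y. \<lbrakk>x \<in> carrier P; y \<in> carrier P\<rbrakk> \<Longrightarrow> \<phi> x = \<phi> y \<longleftrightarrow> x \<ominus>\<^bsub>P\<^esub> y \<in> K"
    by blast
  have \<phi>h: "\<phi> \<in> module_hom R P Q" using epi by (simp add: module_epi_def)
  have \<phi>eq: "\<phi> d = \<phi> e \<longleftrightarrow> \<sigma> d = \<sigma> e" if "d \<in> D" "e \<in> D" for d e
  proof -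
    have "d \<ominus>\<^bsub>P\<^esub> e \<in> D" using that DD(3,4) by (simp add: P.M.minus_eq)
    then show ?thesis
      using that by (simp add: \<phi> DP K_def \<sigma>d Xminus \<sigma>D(1))
  qed
  \<comment> \<open>\<open>\<delta>\<close> chooses preimages under \<open>\<sigma>\<close> without
    any linearity. Still \<open>\<phi> \<circ> \<delta>\<close> is a homomorphism, because on
    \<open>D\<close> the map \<open>\<phi>\<close> identifies exactly the elements with equal values
    under \<open>\<sigma>\<close>.\<close>
  define \<delta> where "\<delta> m = inv_into D \<sigma> (\<alpha> m)" for m
  have \<delta>: "\<delta> m \<in> D" "\<sigma> (\<delta> m) = \<alpha> m" if "m \<in> carrier M" for m
  proof -
    have "\<alpha> m \<in> \<sigma> ` D" using sub that by blast
    then show "\<delta> m \<in> D" "\<sigma> (\<delta> m) = \<alpha> m"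
      by (simp_all add: \<delta>_def inv_into_into f_inv_into_f)
  qed
  have "\<phi> \<circ> \<delta> \<in> module_hom R M Q"
  proof (rule module_homI)
    fix x assume x: "x \<in> carrier M"
    show "(\<phi> \<circ> \<delta>) x \<in> carrier Q" using module_homD(1)[OF \<phi>h] \<delta>(1)[OF x] DP by simp
    fix y assume y: "y \<in> carrier M"
    have "\<phi> (\<delta> (x \<oplus>\<^bsub>M\<^esub> y)) = \<phi> (\<delta> x \<oplus>\<^bsub>P\<^esub> \<delta> y)"
      using x y by (simp add: \<phi>eq DD(3) \<delta> \<sigma>D(2) module_homD(2)[OF \<alpha>])
    then show "(\<phi> \<circ> \<delta>) (x \<oplus>\<^bsub>M\<^esub> y) = (\<phi> \<circ> \<delta>) x \<oplus>\<^bsub>Q\<^esub> (\<phi> \<circ> \<delta>) y"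
      using x y module_homD(2)[OF \<phi>h] \<delta>(1) DP by simp
  next
    fix a x assume ax: "a \<in> carrier R" "x \<in> carrier M"
    have "\<phi> (\<delta> (a \<odot>\<^bsub>M\<^esub> x)) = \<phi> (a \<odot>\<^bsub>P\<^esub> \<delta> x)"
      using ax by (simp add: \<phi>eq DD(5) \<delta> \<sigma>D(3) module_homD(3)[OF \<alpha>])
    then show "(\<phi> \<circ> \<delta>) (a \<odot>\<^bsub>M\<^esub> x) = a \<odot>\<^bsub>Q\<^esub> (\<phi> \<circ> \<delta>) x"
      using ax module_homD(3)[OF \<phi>h] \<delta>(1) DP by simp
  qed
  then obtain \<beta> where \<beta>: "\<beta> \<in> module_hom R M P"
    "\<And>x. x \<in> carrier M \<Longrightarrow> \<phi> (\<beta> x) = \<phi> (\<delta> x)"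
    using proj Q epi unfolding rel_projective_def by (metis comp_apply)
  have \<beta>D: "\<beta> x \<in> D" if x: "x \<in> carrier M" for x
  proof -
    have bP: "\<beta> x \<in> carrier P" using module_homD(1)[OF \<beta>(1)] x .
    have "\<beta> x \<ominus>\<^bsub>P\<^esub> \<delta> x \<in> D"
      using \<phi>[OF bP DP[OF \<delta>(1)[OF x]]] \<beta>(2)[OF x] by (simp add: K_def)
    then have "(\<beta> x \<ominus>\<^bsub>P\<^esub> \<delta> x) \<oplus>\<^bsub>P\<^esub> \<delta> x \<in> D" using DD(3) \<delta>(1)[OF x] by blast
    then show ?thesis using bP DP[OF \<delta>(1)[OF x]]
      by (simp add: P.M.minus_eq P.M.a_assoc P.M.l_neg)
  qed
  show ?thesis
  proof
    show "\<beta> \<in> module_hom R M (P\<lparr>carrier := D\<rparr>)"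
      using \<beta>(1) \<beta>D by (auto simp: module_hom_def)
    show "\<forall>x\<in>carrier M. \<sigma> (\<beta> x) = \<alpha> x"
      using \<beta>(2) \<beta>D \<delta> \<phi>eq by auto
  qed
qed

context left_module
begin

text \<open>Inside \<open>M\<close> + \<open>M\<close> (direct sum, indexed by \<open>bool\<close>)
  the submodule \<open>D\<close> is the external direct sum of \<open>B\<close> and
  \<open>C\<close>, and addition \<open>\<sigma>\<close> maps it onto their sum. Lifting
  \<open>f\<close> along \<open>\<sigma>\<close> and taking the two components gives
  \<open>g\<close> and \<open>h\<close>.\<close>

lemma hom_submodule_split:
  assumes proj: "rel_projective R M (direct_power M (UNIV :: bool set))"
    and B: "submodule B R M" and C: "submodule C R M"
    and f: "f \<in> module_hom R M (M\<lparr>carrier := B <+>\<^bsub>M\<^esub> C\<rparr>)"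
  obtains g h where "g \<in> module_hom R M (M\<lparr>carrier := B\<rparr>)" "h \<in> module_hom R M (M\<lparr>carrier := C\<rparr>)"
    "\<And>x. x \<in> carrier M \<Longrightarrow> f x = g x \<oplus>\<^bsub>M\<^esub> h x"
proof -
  let ?P = "direct_power M (UNIV :: bool set)"
  have P: "left_module R ?P" by (rule left_module_direct_power[OF left_module_axioms])
  interpret P: left_module R ?P by (rule P)
  note BD = submoduleD[OF B] and CD = submoduleD[OF C]
  have BM: "\<And>b. b \<in> B \<Longrightarrow> b \<in> carrier M" and CM: "\<And>c. c \<in> C \<Longrightarrow> c \<in> carrier M"
    using BD(1) CD(1) by auto
  have ev: "(x \<oplus>\<^bsub>?P\<^esub> y) i = x i \<oplus>\<^bsub>M\<^esub> y i" "(a \<odot>\<^bsub>?P\<^esub> x) i = a \<odot>\<^bsub>M\<^esub> x i" "\<zero>\<^bsub>?P\<^esub> i = \<zero>\<^bsub>M\<^esub>" for a x y i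
    by (auto simp: direct_power_def)
  \<comment> \<open>The index set is finite and all of \<open>bool\<close>, so the finite support
    and extensionality conditions are vacuous.\<close>
  have carr: "x \<in> carrier ?P \<longleftrightarrow> (\<forall>i. x i \<in> carrier M)" for x
    by (auto simp: direct_power_def PiE_iff)
  \<comment> \<open>Negation is not a field of the record; its components come from uniqueness of
    additive inverses.\<close>
  have neg: "(\<ominus>\<^bsub>?P\<^esub> x) i = \<ominus>\<^bsub>M\<^esub> x i" if x: "x \<in> carrier ?P" for x i
  proof -
    have "(\<ominus>\<^bsub>?P\<^esub> x) i \<oplus>\<^bsub>M\<^esub> x i = \<zero>\<^bsub>M\<^esub>"
      using P.M.l_neg[OF x] by (metis ev(1,3))
    then show ?thesis using P.M.a_inv_closed[OF x] x carr by (metis M.minus_equality)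
  qed
  define D where "D = {x \<in> carrier ?P. x True \<in> B \<and> x False \<in> C}"
  have D: "submodule D R ?P"
    by (rule P.submoduleI) (use BD CD in \<open>auto simp: D_def ev neg\<close>)
  define \<sigma> where "\<sigma> x = x True \<oplus>\<^bsub>M\<^esub> x False" for x :: "bool \<Rightarrow> 'b"
  have \<sigma>: "\<sigma> \<in> module_hom R (?P\<lparr>carrier := D\<rparr>) M"
    by (rule module_homI) (auto simp: D_def \<sigma>_def ev BM CM smult_r_distr M.a_ac)
  have \<alpha>: "f \<in> module_hom R M M"
    using f submoduleD(1)[OF submodule_set_add[OF B C]] by (auto simp: module_hom_def)
  have "f x \<in> \<sigma> ` D" if "x \<in> carrier M" for x
  proof -
    have "f x \<in> B <+>\<^bsub>M\<^esub> C" using module_homD(1)[OF f that] by simp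
    then obtain b c where bc: "b \<in> B" "c \<in> C" "f x = b \<oplus>\<^bsub>M\<^esub> c"
      by (auto simp: set_add_def')
    then have "f x = \<sigma> (\<lambda>i. if i then b else c)" by (simp add: \<sigma>_def)
    moreover have "(\<lambda>i. if i then b else c) \<in> D" using bc BM CM by (simp add: D_def carr)
    ultimately show ?thesis by blast
  qed
  then obtain \<beta> where \<beta>: "\<beta> \<in> module_hom R M (?P\<lparr>carrier := D\<rparr>)"
      "\<And>x. x \<in> carrier M \<Longrightarrow> \<sigma> (\<beta> x) = f x"
    using rel_projective_lift_submodule[OF left_module_axioms P left_module_axioms proj D \<sigma> \<alpha>]
    by blast
  note \<beta>D = module_homD[OF \<beta>(1), simplified]
  show thesis
  proof
    show "(\<lambda>x. \<beta> x True) \<in> module_hom R M (M\<lparr>carrier := B\<rparr>)"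
      using \<beta>D by (auto intro!: module_homI simp: D_def ev)
    show "(\<lambda>x. \<beta> x False) \<in> module_hom R M (M\<lparr>carrier := C\<rparr>)"
      using \<beta>D by (auto intro!: module_homI simp: D_def ev)
    show "f x = \<beta> x True \<oplus>\<^bsub>M\<^esub> \<beta> x False" if "x \<in> carrier M" for x
      using \<beta>(2)[OF that] by (simp add: \<sigma>_def)
  qed
qed

section \<open>Homomorphisms vanishing on products\<close>

lemma hom_into_submodule:
  assumes "f \<in> module_hom R M (M\<lparr>carrier := B\<rparr>)" "B \<subseteq> carrier M"
  shows "f \<in> module_hom R M M"
  using assms by (auto simp: module_hom_def)

lemma submodule_prodE:
  assumes "y \<in> submodule_prod R M A B"
  obtains F x where "finite F" "F \<subseteq> module_hom R M (M\<lparr>carrier := B\<rparr>)"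
    "\<And>f. f \<in> F \<Longrightarrow> x f \<in> f ` A" "y = (\<Oplus>\<^bsub>M\<^esub>f\<in>F. x f)"
  using assms unfolding submodule_prod_def submodule_sum_def mem_Collect_eq
  by (elim exE conjE, intro that) auto

lemma submodule_prod_subset:
  assumes "A \<subseteq> carrier M" "B \<subseteq> carrier M"
  shows "submodule_prod R M A B \<subseteq> carrier M"
proof
  fix y assume "y \<in> submodule_prod R M A B"
  then obtain F x where F: "finite F" "F \<subseteq> module_hom R M (M\<lparr>carrier := B\<rparr>)"
    "\<And>f. f \<in> F \<Longrightarrow> x f \<in> f ` A" "y = (\<Oplus>\<^bsub>M\<^esub>f\<in>F. x f)"
    by (rule submodule_prodE) (rule that)
  have "x f \<in> carrier M" if f: "f \<in> F" for f
  proof -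
    have "f \<in> module_hom R M M" using F(2) f assms(2) hom_into_submodule by blast
    from module_homD(1)[OF this] have "f ` A \<subseteq> carrier M" using assms(1) by auto
    then show ?thesis using F(3)[OF f] by blast
  qed
  then show "y \<in> carrier M" unfolding F(4) by (intro M.finsum_closed) simp
qed

lemma zero_mem_submodule_prod: "\<zero>\<^bsub>M\<^esub> \<in> submodule_prod R M A B"
  unfolding submodule_prod_def submodule_sum_def
  by (rule CollectI, rule exI[of _ "{}"]) simp

text \<open>The product consists of finite sums of elements \<open>f a\<close>, and \<open>g\<close>
  is additive. This removes the sums from all later arguments and leaves only compositions of
  homomorphisms.\<close>

lemma hom_vanishes_on_prod_iff:
  assumes A: "A \<subseteq> carrier M" and B: "B \<subseteq> carrier M" and g: "g \<in> module_hom R M M"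
  shows "(\<forall>x\<in>submodule_prod R M A B. g x = \<zero>\<^bsub>M\<^esub>) \<longleftrightarrow>
    (\<forall>f\<in>module_hom R M (M\<lparr>carrier := B\<rparr>). \<forall>a\<in>A. g (f a) = \<zero>\<^bsub>M\<^esub>)" (is "?l \<longleftrightarrow> ?r")
proof
  have fA: "f a \<in> carrier M" if "f \<in> module_hom R M (M\<lparr>carrier := B\<rparr>)" "a \<in> A" for f a
    using module_homD(1)[OF hom_into_submodule[OF that(1) B]] that(2) A by blast
  show ?r if ?l
  proof (intro ballI)
    fix f a assume fa: "f \<in> module_hom R M (M\<lparr>carrier := B\<rparr>)" "a \<in> A"
    have "f a = (\<Oplus>\<^bsub>M\<^esub>i\<in>{f}. f a)" using fA[OF fa] by simp
    then have "f a \<in> submodule_prod R M A B"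
      unfolding submodule_prod_def submodule_sum_def using fa
      by (intro CollectI exI[of _ "{f}"] exI[of _ "\<lambda>_. f a"]) auto
    with that show "g (f a) = \<zero>\<^bsub>M\<^esub>" by blast
  qed
  assume r: ?r
  show ?l
  proof
    fix y assume "y \<in> submodule_prod R M A B"
    then obtain F x where F: "finite F" "F \<subseteq> module_hom R M (M\<lparr>carrier := B\<rparr>)"
      "\<And>f. f \<in> F \<Longrightarrow> x f \<in> f ` A" "y = (\<Oplus>\<^bsub>M\<^esub>f\<in>F. x f)"
      by (rule submodule_prodE) (rule that)
    have x: "x f \<in> carrier M \<and> g (x f) = \<zero>\<^bsub>M\<^esub>" if "f \<in> F" for f
      using F(2) F(3)[OF that] that r fA by auto
    \<comment> \<open>The condition on \<open>x\<close> is part of the induction formula, so that it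
      is available for the smaller sets.\<close>
    have "(\<forall>f\<in>F. x f \<in> carrier M \<and> g (x f) = \<zero>\<^bsub>M\<^esub>) \<longrightarrow> g (\<Oplus>\<^bsub>M\<^esub>f\<in>F. x f) = \<zero>\<^bsub>M\<^esub>"
      using F(1)
    proof (induction F rule: finite_induct)
      case empty
      show ?case using module_hom_zero[OF left_module_axioms left_module_axioms g] by simp
    next
      case (insert f F)
      show ?case
      proof
        assume *: "\<forall>f\<in>insert f F. x f \<in> carrier M \<and> g (x f) = \<zero>\<^bsub>M\<^esub>"
        then have "(\<Oplus>\<^bsub>M\<^esub>f\<in>insert f F. x f) = x f \<oplus>\<^bsub>M\<^esub> (\<Oplus>\<^bsub>M\<^esub>f\<in>F. x f)"
          using insert by (intro M.finsum_insert) auto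
        moreover have "(\<Oplus>\<^bsub>M\<^esub>f\<in>F. x f) \<in> carrier M"
          using * by (intro M.finsum_closed) auto
        ultimately show "g (\<Oplus>\<^bsub>M\<^esub>f\<in>insert f F. x f) = \<zero>\<^bsub>M\<^esub>"
          using * insert.IH module_homD(2)[OF g] by simp
      qed
    qed
    then show "g y = \<zero>\<^bsub>M\<^esub>" using x F(4) by blast
  qed
qed

lemma submodule_prod_list_singleton: "submodule_prod_list R M [A] = A"
  by (simp add: submodule_prod_list_def)

lemma submodule_prod_list_snoc:
  assumes "As \<noteq> []"
  shows "submodule_prod_list R M (As @ [B]) = submodule_prod R M (submodule_prod_list R M As) B"
  using assms by (simp add: submodule_prod_list_def)

lemma submodule_prod_list_subset:
  assumes "As \<noteq> []" "\<And>A. A \<in> set As \<Longrightarrow> A \<subseteq> carrier M"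
  shows "submodule_prod_list R M As \<subseteq> carrier M"
  using assms
proof (induction As rule: rev_nonempty_induct)
  case (single A)
  then show ?case by (simp add: submodule_prod_list_singleton)
next
  case (snoc A As)
  then show ?case by (simp add: submodule_prod_list_snoc submodule_prod_subset)
qed

lemma zero_mem_submodule_prod_list:
  assumes "As \<noteq> []" "\<And>A. A \<in> set As \<Longrightarrow> submodule A R M"
  shows "\<zero>\<^bsub>M\<^esub> \<in> submodule_prod_list R M As"
  using assms
proof (induction As rule: rev_nonempty_induct)
  case (single A)
  then show ?case by (simp add: submodule_prod_list_singleton submoduleD(2))
next
  case (snoc A As)
  then show ?case by (simp add: submodule_prod_list_snoc zero_mem_submodule_prod)
qed

text \<open>Because products are bracketed to the left, the last factor can be peeled off:
  \<open>g \<circ> f\<close> then takes the role of \<open>g\<close> on the shorter list. Hence the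
  inductions below run from the right end, with \<open>g\<close> arbitrary.\<close>

lemma hom_vanishes_on_prod_list_snoc_iff:
  assumes "As \<noteq> []" "\<And>A. A \<in> set (As @ [B]) \<Longrightarrow> submodule A R M" "g \<in> module_hom R M M"
  shows "(\<forall>x\<in>submodule_prod_list R M (As @ [B]). g x = \<zero>\<^bsub>M\<^esub>) \<longleftrightarrow>
    (\<forall>f\<in>module_hom R M (M\<lparr>carrier := B\<rparr>). \<forall>x\<in>submodule_prod_list R M As. g (f x) = \<zero>\<^bsub>M\<^esub>)"
proof -
  have "A \<subseteq> carrier M" if "A \<in> set (As @ [B])" for A
    using assms(2)[OF that] submoduleD(1) by blast
  then show ?thesis
    unfolding submodule_prod_list_snoc[OF assms(1)]
    by (intro hom_vanishes_on_prod_iff submodule_prod_list_subset assms(1,3)) simp_all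
qed

section \<open>Expansion of products of sums and absorption of factors\<close>

text \<open>This is multilinear expansion into words over the alphabet \<open>\<V>\<close>. A
  homomorphism into the last factor splits as \<open>h\<close> plus \<open>k\<close> with values in
  letters \<open>B\<close> and \<open>C\<close>, and the induction hypothesis applies to
  \<open>g \<circ> h\<close> and \<open>g \<circ> k\<close>. An inclusion of each factor in a sum of
  two letters suffices.\<close>

lemma hom_vanishes_on_prod_list_of_sums:
  assumes proj: "rel_projective R M (direct_power M (UNIV :: bool set))"
    and V: "\<And>B. B \<in> \<V> \<Longrightarrow> submodule B R M"
    and ne: "As \<noteq> []"
    and As: "\<And>A. A \<in> set As \<Longrightarrow> submodule A R M \<and> (\<exists>B\<in>\<V>. \<exists>C\<in>\<V>. A \<subseteq> B <+>\<^bsub>M\<^esub> C)"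
    and g: "g \<in> module_hom R M M"
    and words: "\<And>Bs. \<lbrakk>length Bs = length As; set Bs \<subseteq> \<V>\<rbrakk> \<Longrightarrow>
      \<forall>x\<in>submodule_prod_list R M Bs. g x = \<zero>\<^bsub>M\<^esub>"
  shows "\<forall>x\<in>submodule_prod_list R M As. g x = \<zero>\<^bsub>M\<^esub>"
  using ne As g words
proof (induction As arbitrary: g rule: rev_nonempty_induct)
  case (single A)
  obtain B C where BC: "B \<in> \<V>" "C \<in> \<V>" "A \<subseteq> B <+>\<^bsub>M\<^esub> C"
    using single.prems(1)[of A] unfolding list.set by blast
  show ?case
  proof
    fix x assume "x \<in> submodule_prod_list R M [A]"
    then obtain b c where x: "b \<in> B" "c \<in> C" "x = b \<oplus>\<^bsub>M\<^esub> c"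
      using BC(3) unfolding submodule_prod_list_singleton set_add_def' by blast
    have "g b = \<zero>\<^bsub>M\<^esub>" "g c = \<zero>\<^bsub>M\<^esub>"
      using single.prems(3)[of "[B]"] single.prems(3)[of "[C]"] BC x
      by (simp_all add: submodule_prod_list_singleton)
    then show "g x = \<zero>\<^bsub>M\<^esub>"
      using x subsetD[OF submoduleD(1)[OF V[OF BC(1)]]] subsetD[OF submoduleD(1)[OF V[OF BC(2)]]]
      by (simp add: module_homD(2)[OF single.prems(2)])
  qed
next
  case (snoc A As)
  obtain B C where BC: "B \<in> \<V>" "C \<in> \<V>" "A \<subseteq> B <+>\<^bsub>M\<^esub> C"
    using snoc.prems(1)[of A] unfolding set_append list.set by blast
  \<comment> \<open>Appending the letter \<open>D\<close> to a word of the length of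
    \<open>As\<close> gives a word killed by \<open>g\<close>, so \<open>g \<circ> h\<close> kills
    every shorter word and the induction hypothesis applies to it.\<close>
  have kill: "g (h x) = \<zero>\<^bsub>M\<^esub>"
    if D: "D \<in> \<V>" and h: "h \<in> module_hom R M (M\<lparr>carrier := D\<rparr>)" and x: "x \<in> submodule_prod_list R M As"
    for D h x
  proof -
    have gh: "g \<circ> h \<in> module_hom R M M"
      using module_hom_comp[OF hom_into_submodule[OF h] snoc.prems(2)] submoduleD(1)[OF V[OF D]]
      by blast
    have "\<forall>x\<in>submodule_prod_list R M As. (g \<circ> h) x = \<zero>\<^bsub>M\<^esub>"
    proof (rule snoc.IH[OF _ gh])
      fix Bs assume Bs: "length Bs = length As" "set Bs \<subseteq> \<V>"
      then have "Bs \<noteq> []" using snoc.hyps by auto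
      then show "\<forall>x\<in>submodule_prod_list R M Bs. (g \<circ> h) x = \<zero>\<^bsub>M\<^esub>"
        using snoc.prems(3)[of "Bs @ [D]"] Bs D h V subsetD[OF Bs(2)]
          hom_vanishes_on_prod_list_snoc_iff[of Bs D g] snoc.prems(2) by auto
    next
      fix A' assume "A' \<in> set As"
      then show "submodule A' R M \<and> (\<exists>B\<in>\<V>. \<exists>C\<in>\<V>. A' \<subseteq> B <+>\<^bsub>M\<^esub> C)"
        using snoc.prems(1)[of A'] by simp
    qed
    then show ?thesis using x by simp
  qed
  have "g (f x) = \<zero>\<^bsub>M\<^esub>"
    if f: "f \<in> module_hom R M (M\<lparr>carrier := A\<rparr>)" and x: "x \<in> submodule_prod_list R M As" for f x
  proof -
    have "f \<in> module_hom R M (M\<lparr>carrier := B <+>\<^bsub>M\<^esub> C\<rparr>)"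
      using f BC(3) by (auto simp: module_hom_def)
    \<comment> \<open>Projectivity enters here.\<close>
    then obtain h k where hk: "h \<in> module_hom R M (M\<lparr>carrier := B\<rparr>)"
      "k \<in> module_hom R M (M\<lparr>carrier := C\<rparr>)" "\<And>x. x \<in> carrier M \<Longrightarrow> f x = h x \<oplus>\<^bsub>M\<^esub> k x"
      by (rule hom_submodule_split[OF proj V[OF BC(1)] V[OF BC(2)]]) (rule that)
    have xM: "x \<in> carrier M"
      using submodule_prod_list_subset[OF snoc.hyps] snoc.prems(1) submoduleD(1) x
      by (metis UnCI set_append subsetD)
    then have "h x \<in> carrier M" "k x \<in> carrier M"
      using module_homD(1)[OF hk(1)] module_homD(1)[OF hk(2)]
        subsetD[OF submoduleD(1)[OF V[OF BC(1)]]] subsetD[OF submoduleD(1)[OF V[OF BC(2)]]]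
      by simp_all
    then show ?thesis
      using kill[OF BC(1) hk(1) x] kill[OF BC(2) hk(2) x]
      by (simp add: hk(3)[OF xM] module_homD(2)[OF snoc.prems(2)])
  qed
  then show ?case
    using hom_vanishes_on_prod_list_snoc_iff[OF snoc.hyps _ snoc.prems(2), of A] snoc.prems(1) by blast
qed

text \<open>Precomposing with arbitrary endomorphisms is what lets the factors of \<open>As\<close> to the
  right of the last factor of \<open>Bs\<close> be absorbed.\<close>

lemma hom_vanishes_on_prod_list_subseq:
  assumes "subseq Bs As" "Bs \<noteq> []" "\<And>A. A \<in> set As \<Longrightarrow> submodule A R M"
    and "g \<in> module_hom R M M"
    and "\<And>f. f \<in> module_hom R M M \<Longrightarrow> \<forall>x\<in>submodule_prod_list R M Bs. g (f x) = \<zero>\<^bsub>M\<^esub>"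
  shows "\<forall>x\<in>submodule_prod_list R M As. g x = \<zero>\<^bsub>M\<^esub>"
  using assms
proof (induction As arbitrary: Bs g rule: rev_induct)
  case Nil
  then show ?case by simp
next
  case (snoc A As)
  have id: "id \<in> module_hom R M M" by (rule module_homI) auto
  have A: "A \<subseteq> carrier M" using snoc.prems(3)[of A] submoduleD(1) by auto
  \<comment> \<open>\<open>C\<close> records whether the last factor \<open>A\<close> is matched by
    the last factor of \<open>Bs\<close> or is skipped.\<close>
  obtain Bs' C where Bs: "Bs = Bs' @ C" "subseq Bs' As" "subseq C [A]"
    using snoc.prems(1) by (auto simp: subseq_append_iff)
  have C: "C = [] \<or> C = [A]"
    using Bs(3) by (cases C) (auto split: if_splits)
  have sub: "submodule B R M" if "B \<in> set Bs'" for B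
    using list_emb_set[OF Bs(2) that] snoc.prems(3) by auto
  have kills: "\<forall>x\<in>submodule_prod_list R M As. g (f x) = \<zero>\<^bsub>M\<^esub>"
    if f: "f \<in> module_hom R M (M\<lparr>carrier := A\<rparr>)" and ne: "As \<noteq> []" for f
  proof (cases "Bs = [A]")
    \<comment> \<open>All of \<open>A\<close> is killed by \<open>g\<close>, and \<open>f\<close>
      has values in \<open>A\<close>; so the factors to the left of \<open>A\<close> are absorbed
      whatever they are.\<close>
    case True
    show ?thesis
    proof
      fix x assume "x \<in> submodule_prod_list R M As"
      then have "x \<in> carrier M"
        using submodule_prod_list_subset[OF ne] snoc.prems(3) submoduleD(1)
        by (metis UnCI set_append subsetD)
      then have "f x \<in> A" using module_homD(1)[OF f] by simp
      then show "g (f x) = \<zero>\<^bsub>M\<^esub>"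
        using snoc.prems(5)[OF id] True by (simp add: submodule_prod_list_singleton)
    qed
  next
    case False
    then have ne': "Bs' \<noteq> []" using Bs(1) C snoc.prems(2) by auto
    have fM: "f \<in> module_hom R M M" by (rule hom_into_submodule[OF f A])
    have "\<forall>x\<in>submodule_prod_list R M As. (g \<circ> f) x = \<zero>\<^bsub>M\<^esub>"
    proof (rule snoc.IH[OF Bs(2) ne' _ module_hom_comp[OF fM snoc.prems(4)]])
      fix k assume k: "k \<in> module_hom R M M"
      \<comment> \<open>If \<open>A\<close> is skipped, \<open>f \<circ> k\<close> is just another
        endomorphism covered by the assumption on \<open>Bs\<close>. If \<open>A\<close> is matched,
        \<open>f \<circ> k\<close> is again a homomorphism into \<open>A\<close>, one of those
        occurring in the product of \<open>Bs' @ [A]\<close>.\<close>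
      show "\<forall>x\<in>submodule_prod_list R M Bs'. (g \<circ> f) (k x) = \<zero>\<^bsub>M\<^esub>"
      proof (cases "C = []")
        case True
        then show ?thesis
          using snoc.prems(5)[OF module_hom_comp[OF k fM]] Bs(1) by simp
      next
        case False
        then have "Bs = Bs' @ [A]" using C Bs(1) by simp
        then have "\<forall>x\<in>submodule_prod_list R M (Bs' @ [A]). g x = \<zero>\<^bsub>M\<^esub>"
          using snoc.prems(5)[OF id] by simp
        moreover have "submodule B R M" if "B \<in> set (Bs' @ [A])" for B
          using that sub snoc.prems(3) by auto
        ultimately have "\<forall>x\<in>submodule_prod_list R M Bs'. g ((f \<circ> k) x) = \<zero>\<^bsub>M\<^esub>"
          using hom_vanishes_on_prod_list_snoc_iff[OF ne' _ snoc.prems(4)] module_hom_comp[OF k f]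
          by blast
        then show ?thesis by simp
      qed
    qed (use snoc.prems(3) in auto)
    then show ?thesis by simp
  qed
  show ?case
  proof (cases "As = []")
    case True
    then have "Bs = [A]" using Bs C snoc.prems(2) by auto
    then show ?thesis using snoc.prems(5)[OF id] True by simp
  next
    case False
    then show ?thesis
      using kills hom_vanishes_on_prod_list_snoc_iff[OF False _ snoc.prems(4), of A] snoc.prems(3)
      by simp
  qed
qed

text \<open>Take \<open>g\<close> to be the identity: endomorphisms fix zero, so a zero product
  stays zero under every precomposition. Thus a word vanishes as soon as some nonempty subword
  does.\<close>

lemma submodule_prod_list_subseq_zero:
  assumes "subseq Bs As" "Bs \<noteq> []" "\<And>A. A \<in> set As \<Longrightarrow> submodule A R M"
    and z: "submodule_prod_list R M Bs = {\<zero>\<^bsub>M\<^esub>}"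
  shows "\<forall>x\<in>submodule_prod_list R M As. x = \<zero>\<^bsub>M\<^esub>"
proof -
  have id: "id \<in> module_hom R M M" by (rule module_homI) auto
  have "\<forall>x\<in>submodule_prod_list R M As. id x = \<zero>\<^bsub>M\<^esub>"
  proof (rule hom_vanishes_on_prod_list_subseq[OF assms(1-3) id])
    fix f assume "f \<in> module_hom R M M"
    then show "\<forall>x\<in>submodule_prod_list R M Bs. id (f x) = \<zero>\<^bsub>M\<^esub>"
      using module_hom_zero[OF left_module_axioms left_module_axioms] by (simp add: z)
  qed
  then show ?thesis by simp
qed

section \<open>Local nilpotence of the sum\<close>

lemma locally_nilpotent_set_add:
  assumes proj: "rel_projective R M (direct_power M (UNIV :: bool set))"
    and N: "locally_nilpotent R M N" and L: "locally_nilpotent R M L"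
  shows "locally_nilpotent R M (N <+>\<^bsub>M\<^esub> L)"
  unfolding locally_nilpotent_def
proof (intro conjI allI impI)
  have Ns: "submodule N R M" and Ls: "submodule L R M"
    using N L by (auto simp: locally_nilpotent_def)
  then show "submodule (N <+>\<^bsub>M\<^esub> L) R M" by (rule submodule_set_add)
  fix S assume S: "finite S \<and> S \<subseteq> N <+>\<^bsub>M\<^esub> L"
  then have "\<forall>s\<in>S. \<exists>n l. n \<in> N \<and> l \<in> L \<and> s = n \<oplus>\<^bsub>M\<^esub> l"
    unfolding set_add_def' by blast
  \<comment> \<open>One decomposition is fixed for each \<open>s\<close>, so local nilpotence of
    \<open>N\<close> and \<open>L\<close> is applied to the finite sets of chosen
    components.\<close>
  then obtain n l where nl: "\<And>s. s \<in> S \<Longrightarrow> n s \<in> N" "\<And>s. s \<in> S \<Longrightarrow> l s \<in> L"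
    "\<And>s. s \<in> S \<Longrightarrow> s = n s \<oplus>\<^bsub>M\<^esub> l s"
    by metis
  obtain p where p: "p > 0" "\<And>ns. \<lbrakk>length ns = p; set ns \<subseteq> n ` S\<rbrakk> \<Longrightarrow>
      submodule_prod_list R M (map (cyclic_submodule R M) ns) = {\<zero>\<^bsub>M\<^esub>}"
    using N S nl(1) unfolding locally_nilpotent_def by (metis finite_imageI image_subsetI)
  obtain q where q: "q > 0" "\<And>ns. \<lbrakk>length ns = q; set ns \<subseteq> l ` S\<rbrakk> \<Longrightarrow>
      submodule_prod_list R M (map (cyclic_submodule R M) ns) = {\<zero>\<^bsub>M\<^esub>}"
    using L S nl(2) unfolding locally_nilpotent_def by (metis finite_imageI image_subsetI)
  let ?T = "n ` S \<union> l ` S"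
  have T: "t \<in> carrier M" if "t \<in> ?T" for t
    using that nl submoduleD(1)[OF Ns] submoduleD(1)[OF Ls] by auto
  have words: "\<forall>x\<in>submodule_prod_list R M (map (cyclic_submodule R M) ts). x = \<zero>\<^bsub>M\<^esub>"
    if ts: "length ts = p + q" "set ts \<subseteq> ?T" for ts
  proof -
    \<comment> \<open>Pigeonhole: the letters of \<open>ts\<close> are divided into
      \<open>us\<close>, from the components in \<open>N\<close>, and \<open>vs\<close>, the
      remaining ones, which come from \<open>L\<close>. Either \<open>us\<close> has at least
      \<open>p\<close> letters or \<open>vs\<close> has more than \<open>q\<close>. A prefix of
      length \<open>p\<close> or \<open>q\<close> is a subword with zero product, and positivity of
      \<open>p\<close> and \<open>q\<close> makes it nonempty.\<close>
    define us where "us = filter (\<lambda>t. t \<in> n ` S) ts"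
    define vs where "vs = filter (\<lambda>t. t \<notin> n ` S) ts"
    have len: "length us + length vs = p + q"
      using sum_length_filter_compl[of "\<lambda>t. t \<in> n ` S" ts] ts(1) by (simp add: us_def vs_def)
    have "\<exists>ws. subseq ws ts \<and> ws \<noteq> [] \<and>
        submodule_prod_list R M (map (cyclic_submodule R M) ws) = {\<zero>\<^bsub>M\<^esub>}"
    proof (cases "p \<le> length us")
      case True
      have "subseq (take p us) ts"
        by (rule subseq_order.order_trans[of _ us]) (auto simp: us_def take_is_prefix)
      moreover have "length (take p us) = p" "set (take p us) \<subseteq> n ` S"
        using True set_take_subset[of p us] by (auto simp: us_def)
      ultimately show ?thesis using p by (metis list.size(3) less_irrefl)
    next
      case False
      have "subseq (take q vs) ts"
        by (rule subseq_order.order_trans[of _ vs]) (auto simp: vs_def take_is_prefix)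
      moreover have "length (take q vs) = q" "set (take q vs) \<subseteq> l ` S"
        using False len ts(2) set_take_subset[of q vs] by (auto simp: vs_def)
      ultimately show ?thesis using q by (metis list.size(3) less_irrefl)
    qed
    then obtain ws where ws: "subseq ws ts" "ws \<noteq> []"
      "submodule_prod_list R M (map (cyclic_submodule R M) ws) = {\<zero>\<^bsub>M\<^esub>}"
      by blast
    show ?thesis
      by (rule submodule_prod_list_subseq_zero[OF subseq_map[OF ws(1)] _ _ ws(3)])
        (use ws(2) ts(2) T in \<open>auto intro!: submodule_cyclic\<close>)
  qed
  show "\<exists>k>0. \<forall>ns. length ns = k \<and> set ns \<subseteq> S \<longrightarrow>
      submodule_prod_list R M (map (cyclic_submodule R M) ns) = {\<zero>\<^bsub>M\<^esub>}"
  proof (intro exI[of _ "p + q"] conjI allI impI)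
    show "p + q > 0" using p(1) by simp
    fix ns assume ns: "length ns = p + q \<and> set ns \<subseteq> S"
    let ?As = "map (cyclic_submodule R M) ns"
    let ?V = "cyclic_submodule R M ` ?T"
    have SM: "s \<in> carrier M" if "s \<in> S" for s
      using S that submoduleD(1)[OF submodule_set_add[OF Ns Ls]] by blast
    have ne: "?As \<noteq> []" using ns p(1) by auto
    have sub: "submodule A R M" if "A \<in> set ?As" for A
      using that ns SM by (auto intro!: submodule_cyclic)
    have cyc: "cyclic_submodule R M s \<subseteq> cyclic_submodule R M (n s) <+>\<^bsub>M\<^esub> cyclic_submodule R M (l s)"
      if s: "s \<in> S" for s
    proof -
      have ns': "n s \<in> carrier M" "l s \<in> carrier M" using s T by auto
      have "a \<odot>\<^bsub>M\<^esub> s = a \<odot>\<^bsub>M\<^esub> n s \<oplus>\<^bsub>M\<^esub> a \<odot>\<^bsub>M\<^esub> l s" if "a \<in> carrier R" for a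
        using smult_r_distr[OF that ns'] nl(3)[OF s] by simp
      then show ?thesis by (fastforce simp: cyclic_submodule_def set_add_def')
    qed
    have id: "id \<in> module_hom R M M" by (rule module_homI) auto
    have "\<forall>x\<in>submodule_prod_list R M ?As. id x = \<zero>\<^bsub>M\<^esub>"
    \<comment> \<open>The alphabet consists of the cyclic submodules generated by the chosen
      components.\<close>
    proof (rule hom_vanishes_on_prod_list_of_sums[OF proj _ ne _ id])
      show "submodule B R M" if "B \<in> ?V" for B
        using that T submodule_cyclic by blast
      show "submodule A R M \<and> (\<exists>B\<in>?V. \<exists>C\<in>?V. A \<subseteq> B <+>\<^bsub>M\<^esub> C)" if A: "A \<in> set ?As" for A
      proof -
        obtain s where s: "s \<in> S" "A = cyclic_submodule R M s" using A ns by auto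
        show ?thesis using sub[OF A] cyc[OF s(1)] s by blast
      qed
      fix Bs assume Bs: "length Bs = length ?As" "set Bs \<subseteq> ?V"
      \<comment> \<open>\<open>words\<close> speaks of lists of elements, so a generator is chosen
        for each letter of \<open>Bs\<close>.\<close>
      then have "Bs \<in> lists ?V" by (simp add: lists_eq_set)
      then obtain ts where ts: "Bs = map (cyclic_submodule R M) ts" "set ts \<subseteq> ?T"
        unfolding lists_image by (auto simp: lists_eq_set)
      then show "\<forall>x\<in>submodule_prod_list R M Bs. id x = \<zero>\<^bsub>M\<^esub>"
        using words[of ts] Bs(1) ns by simp
    qed
    then show "submodule_prod_list R M ?As = {\<zero>\<^bsub>M\<^esub>}"
      using zero_mem_submodule_prod_list[OF ne sub] unfolding id_apply by blast
  qed
qed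

end

theorem lemma3p9:
  fixes R :: "('a, 'r) ring_scheme" and M :: "('a, 'b, 'm) module_scheme"
    and N L :: "'b set"
  assumes "left_module R M"
    and "\<And>\<Lambda> :: (nat \<times> 'b) set. rel_projective R M (direct_power M \<Lambda>)"
    and "locally_nilpotent R M N"
    and "locally_nilpotent R M L"
  shows "locally_nilpotent R M (N <+>\<^bsub>M\<^esub> L)"
  \<comment> \<open>The sum of two copies of \<open>M\<close> is indexed by \<open>bool\<close>,
    which is not the index type of the hypothesis; \<open>rel_projective_all_index_sets\<close>
    makes the transfer.\<close>
  using left_module.locally_nilpotent_set_add[OF assms(1)] rel_projective_all_index_sets[OF assms(1,2)]
    assms(3,4) by blast

end
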